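(* Let $f,\bar f:\mathbb V^{n_x}\to\mathbb V^{n_x}$ be the full-system and truth full-system uncertainty-propagation operators of a network with component operators $f_i,\bar f_i$, $i=1,\dots,n$; let $h$ be a fixed-point operator for $f$ and $\bar h$ a truth fixed-point operator for $\bar f$. Let $x_\star$ be a solution of $x_\star=f(x_\star)$ (so that $x_\star=h(x_\star)$) and $\bar x_\star$ a solution of $\bar x_\star=\bar f(\bar x_\star)$ (so that $\bar x_\star=\bar h(\bar x_\star)$). Assume: (i) There is a Lipschitz constant $L_h<1$ with $\|h(x_1)-h(x_2)\|\le L_h\|x_1-x_2\|$ for all $x_1,x_2\in\mathbb V^{n_x}$. (ii) For each $i$ there are linear subspaces $\mathbb X_i\subseteq\bar{\mathbb X}_i\subseteq\mathbb V^{n_{x,i}}$ with $\mathrm{Im}(f_i)\subseteq\mathbb X_i$ and $\mathrm{Im}(\bar f_i)\subseteq\bar{\mathbb X}_i$. Let $P$ be the orthogonal projector onto $\mathbb X=\mathbb X_1\times\cdots\times\mathbb X_n$. Then the in-plane error satisfies $$\|P\bar x_\star-x_\star\|\le\frac{1}{1-L_h}\,\|P\bar x_\star-h(P\bar x_\star)\|.$$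
   Context: $\mathbb V$ is the real vector space of real-valued random variables on a fixed probability space, with norm induced by an inner product (e.g. $\|x\|=\sqrt{\mathbb E[x^2]}$); it may be treated as an abstract real inner product space. $\mathbb V^N$ carries the product inner product (sum of the componentwise inner products) and its norm. Network: there are $n$ components; component $i$ has $n_{y,i}$ endogenous inputs and $n_{x,i}$ outputs, $n_y=\sum_i n_{y,i}$, $n_x=\sum_i n_{x,i}$. Exogenous inputs are fixed throughout and suppressed from the notation. Each component has an uncertainty-propagation operator $f_i:\mathbb V^{n_{y,i}}\to\mathbb V^{n_{x,i}}$ and a "truth" operator $\bar f_i:\mathbb V^{n_{y,i}}\to\mathbb V^{n_{x,i}}$. $E_i^x\in\{0,1\}^{n_{x,i}\times n_x}$ and $E_i^y\in\{0,1\}^{n_{y,i}\times n_y}$ are the rows of the identity matrix extracting the block of component $i$. The adjacency matrix $A\in\{0,1\}^{n_y\times n_x}$ expresses the endogenous inputs as outputs, $y=Ax$; its diagonal blocks $E_i^yA(E_i^x)^T$ are zero. The full-system operators are $$f(x)=\sum_{i=1}^n(E_i^x)^Tf_i(E_i^yAx),\qquad \bar f(x)=\sum_{i=1}^n(E_i^x)^T\bar f_i(E_i^yAx).$$ A fixed-point operator for $f$ is any function $h:\mathbb V^{n_x}\to\mathbb V^{n_x}$ such that $x\mapsto x-h(x)$ and $x\mapsto x-f(x)$ have the same roots; a truth fixed-point operator is any function $\bar h:\mathbb V^{n_x}\to\mathbb V^{n_x}$ such that $x\mapsto x-\bar h(x)$ and $x\mapsto x-\bar f(x)$ have the same roots.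 The orthogonal projectors $P_i$ onto $\mathbb X_i$ are assumed to exist: $P_i$ is the linear operator with $P_iz=\arg\min_{\tilde z\in\mathbb X_i}\|z-\tilde z\|$, and $P=\sum_{i=1}^n(E_i^x)^TP_iE_i^x$. *)

theory Defs
  imports "Jordan_Normal_Form.Matrix" "HOL-Analysis.Inner_Product"
begin

text \<open>
  The space of random variables is an arbitrary real inner product space \<open>'v\<close>, and its power with
  exponent \<open>N\<close> is \<^term>\<open>carrier_vec N\<close> in the type \<open>'v vec\<close>. Components and block sizes are indexed
  from 0. The scalar operations on \<open>'v vec\<close> in the library multiply by entries, so the action of real
  scalars and real matrices on vectors with entries in \<open>'v\<close> is defined here.
\<close>

definition vinner :: "'v::real_inner vec \<Rightarrow> 'v vec \<Rightarrow> real" where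
  "vinner v w = (\<Sum>j<dim_vec v. inner (v $ j) (w $ j))"

definition vnorm :: "'v::real_inner vec \<Rightarrow> real" where
  "vnorm v = sqrt (vinner v v)"

definition vscale :: "real \<Rightarrow> 'v::real_vector vec \<Rightarrow> 'v vec" where
  "vscale c v = map_vec (\<lambda>a. c *\<^sub>R a) v"

definition mat_app :: "real mat \<Rightarrow> 'v::real_vector vec \<Rightarrow> 'v vec" where
  "mat_app M v = vec (dim_row M) (\<lambda>r. \<Sum>c<dim_col M. (M $$ (r, c)) *\<^sub>R (v $ c))"

definition vsubspace :: "nat \<Rightarrow> 'v::real_vector vec set \<Rightarrow> bool" where
  "vsubspace N S \<longleftrightarrow> S \<subseteq> carrier_vec N \<and> 0\<^sub>v N \<in> S \<and>
     (\<forall>v\<in>S. \<forall>w\<in>S. v + w \<in> S) \<and> (\<forall>c. \<forall>v\<in>S. vscale c v \<in> S)"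

definition linear_operator :: "nat \<Rightarrow> ('v::real_vector vec \<Rightarrow> 'v vec) \<Rightarrow> bool" where
  "linear_operator N T \<longleftrightarrow> T \<in> carrier_vec N \<rightarrow> carrier_vec N \<and>
     (\<forall>v\<in>carrier_vec N. \<forall>w\<in>carrier_vec N. T (v + w) = T v + T w) \<and>
     (\<forall>c. \<forall>v\<in>carrier_vec N. T (vscale c v) = vscale c (T v))"

definition orthogonal_projector ::
    "nat \<Rightarrow> 'v::real_inner vec set \<Rightarrow> ('v vec \<Rightarrow> 'v vec) \<Rightarrow> bool" where
  "orthogonal_projector N S T \<longleftrightarrow> linear_operator N T \<and>
     (\<forall>z\<in>carrier_vec N. is_arg_min (\<lambda>w. vnorm (z - w)) (\<lambda>w. w \<in> S) (T z))"

definition total_dim :: "nat \<Rightarrow> (nat \<Rightarrow> nat) \<Rightarrow> nat" where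
  "total_dim n d = (\<Sum>i<n. d i)"

text \<open>\<open>block_rows n d i\<close> consists of the rows of the identity matrix that extract block \<open>i\<close> of a vector
  partitioned into \<open>n\<close> consecutive blocks of sizes \<open>d 0, \<dots>, d (n - 1)\<close>; it is meant for \<open>i < n\<close>.\<close>

definition block_rows :: "nat \<Rightarrow> (nat \<Rightarrow> nat) \<Rightarrow> nat \<Rightarrow> real mat" where
  "block_rows n d i = mat (d i) (total_dim n d) (\<lambda>(r, c). 1\<^sub>m (total_dim n d) $$ ((\<Sum>k<i. d k) + r, c))"

definition adjacency_matrix :: "nat \<Rightarrow> (nat \<Rightarrow> nat) \<Rightarrow> (nat \<Rightarrow> nat) \<Rightarrow> real mat \<Rightarrow> bool" where
  "adjacency_matrix n nx ny A \<longleftrightarrow>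
     A \<in> carrier_mat (total_dim n ny) (total_dim n nx) \<and> elements_mat A \<subseteq> {0, 1} \<and>
     (\<forall>i<n. block_rows n ny i * A * transpose_mat (block_rows n nx i) = 0\<^sub>m (ny i) (nx i))"

definition component_operators ::
    "nat \<Rightarrow> (nat \<Rightarrow> nat) \<Rightarrow> (nat \<Rightarrow> nat) \<Rightarrow> (nat \<Rightarrow> 'v::real_inner vec \<Rightarrow> 'v vec) \<Rightarrow> bool" where
  "component_operators n nx ny f \<longleftrightarrow> (\<forall>i<n. f i \<in> carrier_vec (ny i) \<rightarrow> carrier_vec (nx i))"

definition system_operator ::
    "nat \<Rightarrow> (nat \<Rightarrow> nat) \<Rightarrow> (nat \<Rightarrow> nat) \<Rightarrow> real mat \<Rightarrow> (nat \<Rightarrow> 'v::real_inner vec \<Rightarrow> 'v vec)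
      \<Rightarrow> 'v vec \<Rightarrow> 'v vec" where
  "system_operator n nx ny A f x =
     finsum_vec TYPE('v) (total_dim n nx)
       (\<lambda>i. mat_app (transpose_mat (block_rows n nx i)) (f i (mat_app (block_rows n ny i) (mat_app A x)))) {..<n}"

definition system_projector ::
    "nat \<Rightarrow> (nat \<Rightarrow> nat) \<Rightarrow> (nat \<Rightarrow> 'v::real_inner vec \<Rightarrow> 'v vec) \<Rightarrow> 'v vec \<Rightarrow> 'v vec" where
  "system_projector n nx P x =
     finsum_vec TYPE('v) (total_dim n nx)
       (\<lambda>i. mat_app (transpose_mat (block_rows n nx i)) (P i (mat_app (block_rows n nx i) x))) {..<n}"

definition fixed_point_operator ::
    "nat \<Rightarrow> ('v::real_inner vec \<Rightarrow> 'v vec) \<Rightarrow> ('v vec \<Rightarrow> 'v vec) \<Rightarrow> bool" where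
  "fixed_point_operator N f h \<longleftrightarrow> h \<in> carrier_vec N \<rightarrow> carrier_vec N \<and>
     {x \<in> carrier_vec N. x - h x = 0\<^sub>v N} = {x \<in> carrier_vec N. x - f x = 0\<^sub>v N}"

end

theory Submission
  imports Defs "HOL-Analysis.L2_Norm"
begin

text \<open>
  Write \<open>p = P x_bar_star\<close>. This is an a posteriori estimate for the contraction \<open>h\<close>: its residual
  \<open>p - h p\<close> at any point \<open>p\<close> controls the distance from \<open>p\<close> to the fixed point \<open>x_star\<close>. Indeed
  \<open>p - x_star = (p - h p) + (h p - h x_star)\<close>, so by the triangle inequality the distance is at most
  the norm of the residual plus \<open>L\<^sub>h\<close> times the distance itself; since \<open>L\<^sub>h < 1\<close>, the last term can
  be absorbed on the left (\<open>contraction_residual_bound\<close>). The estimate applies at \<open>P x_bar_star\<close> because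
  the projection is again a vector of the full system (\<open>system_projector_closed\<close>), and at \<open>x_star\<close>
  because every fixed point of \<open>f\<close> is one of \<open>h\<close> (\<open>fixed_point_operator_fixed\<close>).
\<close>

text \<open>The triangle inequality for \<^const>\<open>vnorm\<close> is that of the Euclidean norm on real tuples, applied
  to the tuple of norms of the entries.\<close>

lemma vnorm_eq_L2_set: "vnorm v = L2_set (\<lambda>j. norm (v $ j)) {..<dim_vec v}"
  by (simp add: vnorm_def vinner_def L2_set_def power2_norm_eq_inner)

lemma vnorm_triangle_ineq:
  assumes "v \<in> carrier_vec N" and "w \<in> carrier_vec N"
  shows "vnorm (v + w) \<le> vnorm v + vnorm w"
proof -
  have "vnorm (v + w) = L2_set (\<lambda>j. norm (v $ j + w $ j)) {..<N}"
    using assms by (auto simp: vnorm_eq_L2_set intro!: L2_set_cong)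
  also have "\<dots> \<le> L2_set (\<lambda>j. norm (v $ j) + norm (w $ j)) {..<N}"
    by (rule L2_set_mono) (auto intro: norm_triangle_ineq)
  also have "\<dots> \<le> L2_set (\<lambda>j. norm (v $ j)) {..<N} + L2_set (\<lambda>j. norm (w $ j)) {..<N}"
    by (rule L2_set_triangle_ineq)
  also have "\<dots> = vnorm v + vnorm w"
    using assms by (simp add: vnorm_eq_L2_set)
  finally show ?thesis .
qed

text \<open>One application of \<open>g\<close> shrinks the distance to \<open>a\<close> by the factor \<open>L\<close>, so the step from \<open>p\<close> to
  \<open>g p\<close> has to cover at least the fraction \<open>1 - L\<close> of that distance.\<close>

lemma contraction_residual_bound:
  fixes g :: "'v::real_inner vec \<Rightarrow> 'v vec" and L :: real
  assumes g: "g \<in> carrier_vec N \<rightarrow> carrier_vec N"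
    and lipschitz: "\<And>x y. x \<in> carrier_vec N \<Longrightarrow> y \<in> carrier_vec N \<Longrightarrow>
           vnorm (g x - g y) \<le> L * vnorm (x - y)"
    and "L < 1"
    and a: "a \<in> carrier_vec N" "g a = a"
    and p: "p \<in> carrier_vec N"
  shows "vnorm (p - a) \<le> 1 / (1 - L) * vnorm (p - g p)"
proof -
  have gp: "g p \<in> carrier_vec N"
    using g p by auto
  have "p - a = (p - g p) + (g p - a)"
    using a(1) p gp by (intro eq_vecI) auto
  then have "vnorm (p - a) \<le> vnorm (p - g p) + vnorm (g p - a)"
    using vnorm_triangle_ineq[of "p - g p" N "g p - a"] a(1) p gp by simp
  also have "vnorm (g p - a) \<le> L * vnorm (p - a)"
    using lipschitz[OF p a(1)] a(2) by simp
  finally have "(1 - L) * vnorm (p - a) \<le> vnorm (p - g p)"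
    by (simp add: algebra_simps)
  with \<open>L < 1\<close> show ?thesis
    by (simp add: field_simps)
qed

lemma fixed_point_operator_fixed:
  assumes h: "fixed_point_operator N f h" and x: "x \<in> carrier_vec N" and fixed: "x = f x"
  shows "h x = x"
proof -
  have hx: "h x \<in> carrier_vec N"
    using h x by (auto simp: fixed_point_operator_def)
  have "x - f x = 0\<^sub>v N"
    using x fixed[symmetric] by simp
  then have root: "x - h x = 0\<^sub>v N"
    using h x by (auto simp: fixed_point_operator_def)
  show ?thesis
  proof (rule eq_vecI)
    fix j assume "j < dim_vec x"
    then show "h x $ j = x $ j"
      using arg_cong[OF root, of "\<lambda>v. v $ j"] x hx by simp
  qed (use x hx in simp)
qed

text \<open>The transposed extraction matrices embed every projected block into the full space.\<close>

lemma system_projector_closed: "system_projector n nx Pc x \<in> carrier_vec (total_dim n nx)"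
  unfolding system_projector_def
  by (rule finsum_vec_closed) (auto simp: mat_app_def block_rows_def)

theorem proposition5p7:
  fixes n :: nat and nx ny :: "nat \<Rightarrow> nat" and A :: "real mat"
    and fc fc_bar :: "nat \<Rightarrow> 'v::real_inner vec \<Rightarrow> 'v vec"
    and f f_bar h h_bar :: "'v vec \<Rightarrow> 'v vec"
    and x_star x_bar_star :: "'v vec"
    and L\<^sub>h :: real
    and \<X> \<X>_bar :: "nat \<Rightarrow> 'v vec set"
    and Pc :: "nat \<Rightarrow> 'v vec \<Rightarrow> 'v vec" and P :: "'v vec \<Rightarrow> 'v vec"
  assumes "adjacency_matrix n nx ny A"
    and "component_operators n nx ny fc"
    and "component_operators n nx ny fc_bar"
    and "f = system_operator n nx ny A fc"
    and "f_bar = system_operator n nx ny A fc_bar"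
    and "fixed_point_operator (total_dim n nx) f h"
    and "fixed_point_operator (total_dim n nx) f_bar h_bar"
    and "x_star \<in> carrier_vec (total_dim n nx)" and "x_star = f x_star"
    and "x_bar_star \<in> carrier_vec (total_dim n nx)" and "x_bar_star = f_bar x_bar_star"
    and "L\<^sub>h < 1"
    and "\<And>x1 x2. x1 \<in> carrier_vec (total_dim n nx) \<Longrightarrow> x2 \<in> carrier_vec (total_dim n nx) \<Longrightarrow>
           vnorm (h x1 - h x2) \<le> L\<^sub>h * vnorm (x1 - x2)"
    and "\<And>i. i < n \<Longrightarrow> vsubspace (nx i) (\<X> i)"
    and "\<And>i. i < n \<Longrightarrow> vsubspace (nx i) (\<X>_bar i)"
    and "\<And>i. i < n \<Longrightarrow> \<X> i \<subseteq> \<X>_bar i"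
    and "\<And>i. i < n \<Longrightarrow> fc i ` carrier_vec (ny i) \<subseteq> \<X> i"
    and "\<And>i. i < n \<Longrightarrow> fc_bar i ` carrier_vec (ny i) \<subseteq> \<X>_bar i"
    and "\<And>i. i < n \<Longrightarrow> orthogonal_projector (nx i) (\<X> i) (Pc i)"
    and "P = system_projector n nx Pc"
  shows "vnorm (P x_bar_star - x_star) \<le> 1 / (1 - L\<^sub>h) * vnorm (P x_bar_star - h (P x_bar_star))"
proof -
  have "h \<in> carrier_vec (total_dim n nx) \<rightarrow> carrier_vec (total_dim n nx)"
    using assms(6) by (simp add: fixed_point_operator_def)
  moreover have "h x_star = x_star"
    using assms(6,8,9) by (rule fixed_point_operator_fixed)
  moreover have "P x_bar_star \<in> carrier_vec (total_dim n nx)"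
    using assms(20) by (simp add: system_projector_closed)
  ultimately show ?thesis
    using contraction_residual_bound assms(8,12,13) by blast
qed

end
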